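(* Let $X$ be a Tychonoff space and let $\mathscr{P}$ be an ideal of closed sets in $X$. Then the annihilator graph $AG(C_\mathscr{P}(X))$ is a subgraph of the weakly zero divisor graph $W\Gamma(C_\mathscr{P}(X))$ (both graphs have vertex set $Z(C_\mathscr{P}(X))^*$).
   Context: $C(X)$ is the ring of all real valued continuous functions on the Tychonoff (completely regular Hausdorff) space $X$; $Z(f)=\{x\in X: f(x)=0\}$. An ideal of closed sets in $X$ is a nonempty family $\mathscr{P}$ of closed subsets of $X$ such that $A,B\in\mathscr{P}$ implies $A\cup B\in\mathscr{P}$, and $A\in\mathscr{P}$, $C\subset A$ with $C$ closed in $X$ implies $C\in\mathscr{P}$. $C_\mathscr{P}(X)=\{f\in C(X): cl_X(X\setminus Z(f))\in\mathscr{P}\}$, a commutative ring (possibly without identity). For a commutative ring $R$, $Z(R)^*$ is the set of nonzero zero divisors, i.e. nonzero $a\in R$ with $ab=0$ for some nonzero $b\in R$, and $ann(a)=\{r\in R: ra=0\}$. The annihilator graph $AG(R)$ is the simple graph with vertex set $Z(R)^*$ in which distinct $a,b$ are adjacent iff $ann(a)\cup ann(b)\neq ann(ab)$. The weakly zero divisor graph $W\Gamma(R)$ is the simple graph with vertex set $Z(R)^*$ in which distinct $a,b$ are adjacent iff there exist $c\in ann(a)\setminus\{0\}$ and $d\in ann(b)\setminus\{0\}$ with $cd=0$. *)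

theory Defs
  imports "HOL-Analysis.Analysis" "HOL-Library.Function_Algebras" "Graph_Theory.Pair_Digraph"
    "Graph_Theory.Digraph_Component"
begin

definition ideal_of_closed_sets :: "'a topology \<Rightarrow> 'a set set \<Rightarrow> bool" where
  "ideal_of_closed_sets X P \<longleftrightarrow>
     P \<noteq> {} \<and> (\<forall>A\<in>P. closedin X A) \<and>
     (\<forall>A\<in>P. \<forall>B\<in>P. A \<union> B \<in> P) \<and>
     (\<forall>A\<in>P. \<forall>C. C \<subseteq> A \<and> closedin X C \<longrightarrow> C \<in> P)"

text \<open>
  The space is the carrier \<open>topspace X\<close>, while elements of the ring have type \<open>'a \<Rightarrow> real\<close>.
  Requiring the value \<open>0\<close> off the carrier makes each continuous function on \<open>X\<close> have exactly
  one representative; these representatives are closed under the pointwise operations of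
  \<^theory>\<open>HOL-Library.Function_Algebras\<close>, whose \<open>0\<close>, \<open>+\<close> and \<open>*\<close> serve as ring operations.
  (The representative of the constant \<open>1\<close> is the indicator of \<open>topspace X\<close>.)
\<close>

definition cont_funs :: "'a topology \<Rightarrow> ('a \<Rightarrow> real) set" where
  "cont_funs X = {f. continuous_map X euclideanreal f \<and> (\<forall>x. x \<notin> topspace X \<longrightarrow> f x = 0)}"

definition zero_set :: "'a topology \<Rightarrow> ('a \<Rightarrow> real) \<Rightarrow> 'a set" where
  "zero_set X f = {x \<in> topspace X. f x = 0}"

definition C_ideal :: "'a topology \<Rightarrow> 'a set set \<Rightarrow> ('a \<Rightarrow> real) set" where
  "C_ideal X P = {f \<in> cont_funs X. X closure_of (topspace X - zero_set X f) \<in> P}"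

text \<open>
  A commutative ring, possibly without identity, is given below by its underlying set \<open>R\<close> inside
  an ambient type of class \<^class>\<open>comm_ring\<close> (which does not require an identity); \<open>R\<close> is meant to
  be closed under the ring operations.  All quantifiers range over \<open>R\<close>, not over the
  ambient type.
\<close>

definition subrng :: "'r::comm_ring set \<Rightarrow> bool" where
  "subrng R \<longleftrightarrow> 0 \<in> R \<and> (\<forall>a\<in>R. \<forall>b\<in>R. a - b \<in> R \<and> a * b \<in> R)"

definition ann :: "'r::comm_ring set \<Rightarrow> 'r \<Rightarrow> 'r set" where
  "ann R a = {r \<in> R. r * a = 0}"

definition zero_divisors :: "'r::comm_ring set \<Rightarrow> 'r set" where
  "zero_divisors R = {a \<in> R. a \<noteq> 0 \<and> (\<exists>b\<in>R. b \<noteq> 0 \<and> a * b = 0)}"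

text \<open>
  A simple graph is a loop-free symmetric digraph without parallel arcs: an edge between \<open>a\<close> and
  \<open>b\<close> is the pair of arcs \<open>(a, b)\<close> and \<open>(b, a)\<close>.
\<close>

definition annihilator_graph :: "'r::comm_ring set \<Rightarrow> 'r pair_pre_digraph" where
  "annihilator_graph R =
     \<lparr> pverts = zero_divisors R,
       parcs = {(a, b). a \<in> zero_divisors R \<and> b \<in> zero_divisors R \<and> a \<noteq> b \<and>
                        ann R a \<union> ann R b \<noteq> ann R (a * b)} \<rparr>"

definition weakly_zero_divisor_graph :: "'r::comm_ring set \<Rightarrow> 'r pair_pre_digraph" where
  "weakly_zero_divisor_graph R =
     \<lparr> pverts = zero_divisors R,
       parcs = {(a, b). a \<in> zero_divisors R \<and> b \<in> zero_divisors R \<and> a \<noteq> b \<and>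
                        (\<exists>c \<in> ann R a - {0}. \<exists>d \<in> ann R b - {0}. c * d = 0)} \<rparr>"

lemma subrng_C_ideal:
  assumes "ideal_of_closed_sets X P"
  shows "subrng (C_ideal X P)"
proof -
  have sub: "C \<in> P" if "A \<in> P" "C \<subseteq> A" "closedin X C" for A C
    using assms that unfolding ideal_of_closed_sets_def by blast
  have un: "A \<union> B \<in> P" if "A \<in> P" "B \<in> P" for A B
    using assms that unfolding ideal_of_closed_sets_def by blast
  have cf: "f \<in> C_ideal X P" if "f \<in> cont_funs X" "A \<in> P"
    "X closure_of (topspace X - zero_set X f) \<subseteq> A" for f A
    using that sub[OF that(2,3)] by (simp add: C_ideal_def)
  obtain A where A: "A \<in> P"
    using assms by (auto simp: ideal_of_closed_sets_def)
  have "0 \<in> C_ideal X P"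
  proof (rule cf[OF _ A])
    have "continuous_map X euclideanreal (\<lambda>x. 0)" by simp
    then show "0 \<in> cont_funs X" by (simp add: cont_funs_def zero_fun_def)
    have "topspace X - zero_set X 0 = {}" by (auto simp: zero_set_def)
    then show "X closure_of (topspace X - zero_set X 0) \<subseteq> A"
      by (simp only: closure_of_empty empty_subsetI)
  qed
  moreover have "f - g \<in> C_ideal X P \<and> f * g \<in> C_ideal X P"
    if f: "f \<in> C_ideal X P" and g: "g \<in> C_ideal X P" for f g
  proof -
    let ?S = "\<lambda>h. topspace X - zero_set X h"
    have P: "X closure_of ?S f \<union> X closure_of ?S g \<in> P"
      using f g un by (simp add: C_ideal_def)
    have c: "f \<in> cont_funs X" "g \<in> cont_funs X"
      using f g by (auto simp: C_ideal_def)
    have "f - g \<in> cont_funs X" "f * g \<in> cont_funs X"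
      using c by (auto simp: cont_funs_def fun_diff_def times_fun_def
          intro!: continuous_map_diff continuous_map_real_mult)
    moreover have "X closure_of ?S h \<subseteq> X closure_of ?S f \<union> X closure_of ?S g"
      if "?S h \<subseteq> ?S f \<union> ?S g" for h
      using closure_of_mono[OF that] by (simp add: closure_of_Un)
    moreover have "?S (f - g) \<subseteq> ?S f \<union> ?S g" "?S (f * g) \<subseteq> ?S f \<union> ?S g"
      by (auto simp: zero_set_def)
    ultimately show ?thesis using cf[OF _ P] by blast
  qed
  ultimately show ?thesis by (simp add: subrng_def)
qed

lemma simple_annihilator_graph: "pair_bidirected_digraph (annihilator_graph R)"
proof unfold_locales
  show "symmetric (with_proj (annihilator_graph R))"
    unfolding symmetric_def with_proj_simps
    by (rule symI) (auto simp: annihilator_graph_def mult.commute Un_commute)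
qed (auto simp: annihilator_graph_def)

lemma simple_weakly_zero_divisor_graph: "pair_bidirected_digraph (weakly_zero_divisor_graph R)"
proof unfold_locales
  show "symmetric (with_proj (weakly_zero_divisor_graph R))"
    unfolding symmetric_def with_proj_simps
    by (rule symI) (simp add: weakly_zero_divisor_graph_def, metis mult.commute)
qed (auto simp: weakly_zero_divisor_graph_def)

end

theory Submission
  imports Defs
begin

text \<open>
  The inclusion is purely algebraic and holds over every commutative ring \<open>R\<close>, with or without
  identity.  Always \<open>ann a \<union> ann b \<subseteq> ann (a * b)\<close>, so an edge of the annihilator graph
  yields \<open>r\<close> with \<open>r * (a * b) = 0\<close> while \<open>r * a \<noteq> 0\<close> and \<open>r * b \<noteq> 0\<close>.  The
  swapped multiples \<open>r * b\<close> and \<open>r * a\<close> are then nonzero elements of \<open>ann a\<close> and \<open>ann b\<close>,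
  and their product contains the factor \<open>r * (a * b)\<close>; hence they witness that \<open>a\<close> and \<open>b\<close> are
  adjacent in the weakly zero divisor graph.  The argument applies to
  \<open>C_ideal X P\<close> because an ideal of closed sets makes it closed under the ring
  operations (\<open>subrng_C_ideal\<close>).
\<close>

lemma ann_Un_subset_ann_mult:
  "ann R a \<union> ann R b \<subseteq> ann R (a * b)"
proof
  fix r assume r: "r \<in> ann R a \<union> ann R b"
  have "r * (a * b) = (r * a) * b" "r * (a * b) = (r * b) * a"
    by (simp_all only: ac_simps)
  with r show "r \<in> ann R (a * b)" by (auto simp: ann_def)
qed

text \<open>
  Let \<open>r\<close> annihilate \<open>a * b\<close> but neither \<open>a\<close> nor \<open>b\<close>.  Multiplying \<open>r\<close> by the \<^emph>\<open>other\<close>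
  element makes it annihilate each factor, and the multiples \<open>r * b\<close> and \<open>r * a\<close> are nonzero
  precisely because \<open>r\<close> lies in neither \<open>ann R b\<close> nor \<open>ann R a\<close>.
\<close>

lemma orthogonal_annihilators_if_ann_mult_neq:
  assumes R: "subrng R" and a: "a \<in> R" and b: "b \<in> R"
    and neq: "ann R a \<union> ann R b \<noteq> ann R (a * b)"
  shows "\<exists>c \<in> ann R a - {0}. \<exists>d \<in> ann R b - {0}. c * d = 0"
proof -
  obtain r where r: "r \<in> R" "r * (a * b) = 0" "r * a \<noteq> 0" "r * b \<noteq> 0"
    using ann_Un_subset_ann_mult[of R a b] neq by (auto simp: ann_def)
  have mem: "r * b \<in> R" "r * a \<in> R"
    using R r(1) a b by (auto simp: subrng_def)
  have "(r * b) * a = r * (a * b)" "(r * a) * b = r * (a * b)"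
    "(r * b) * (r * a) = r * (r * (a * b))"
    by (simp_all only: ac_simps)
  then have "r * b \<in> ann R a - {0}" "r * a \<in> ann R b - {0}" "(r * b) * (r * a) = 0"
    using r mem by (simp_all add: ann_def)
  then show ?thesis by blast
qed

lemma annihilator_graph_subgraph_weakly_zero_divisor_graph:
  assumes "subrng R"
  shows "subgraph (with_proj (annihilator_graph R)) (with_proj (weakly_zero_divisor_graph R))"
proof -
  interpret A: pair_bidirected_digraph "annihilator_graph R"
    by (rule simple_annihilator_graph)
  interpret W: pair_bidirected_digraph "weakly_zero_divisor_graph R"
    by (rule simple_weakly_zero_divisor_graph)
  have "parcs (annihilator_graph R) \<subseteq> parcs (weakly_zero_divisor_graph R)"
  proof (rule subrelI)
    fix a b assume "(a, b) \<in> parcs (annihilator_graph R)"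
    then have ab: "a \<in> zero_divisors R" "b \<in> zero_divisors R" "a \<noteq> b"
      and neq: "ann R a \<union> ann R b \<noteq> ann R (a * b)"
      by (simp_all add: annihilator_graph_def)
    from ab have "a \<in> R" "b \<in> R"
      by (simp_all add: zero_divisors_def)
    from orthogonal_annihilators_if_ann_mult_neq[OF assms this neq] ab
    show "(a, b) \<in> parcs (weakly_zero_divisor_graph R)"
      by (simp add: weakly_zero_divisor_graph_def)
  qed
  moreover have "pverts (annihilator_graph R) = pverts (weakly_zero_divisor_graph R)"
    by (simp add: annihilator_graph_def weakly_zero_divisor_graph_def)
  ultimately show ?thesis
    by (simp add: subgraph_def compatible_def A.wf_digraph W.wf_digraph)
qed

theorem theorem3p4:
  fixes X :: "'a topology" and P :: "'a set set"
  assumes "completely_regular_space X" and "Hausdorff_space X"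
    and "ideal_of_closed_sets X P"
  shows "subgraph (with_proj (annihilator_graph (C_ideal X P)))
                  (with_proj (weakly_zero_divisor_graph (C_ideal X P)))"
  using assms(3)
  by (intro annihilator_graph_subgraph_weakly_zero_divisor_graph subrng_C_ideal)

end
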